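(* Let $N\in\mathbb{N}$ and let $B\subset\mathcal{W}_{\le N}$ be a subset of words. The set $B$ is a basis of words for $\mathcal{W}_N$ if and only if for each pure word $\gamma\in\mathcal{PW}_{\le N}$, the set $B\cap\mathcal{W}_{\le N}(\gamma)$ is a basis of words for $\mathcal{W}_N(\gamma)$.
   Context: $\mathbb{N}=\{0,1,2,\dots\}$. Fix an integer $d\ge 1$ and the alphabet $\mathcal{A}=\{0,1,\dots,d\}$. $\mathcal{W}_N$ is the set of words of length $N$ over $\mathcal{A}$ (with $\mathcal{W}_0=\{\epsilon\}$, $\epsilon$ the empty word), $\mathcal{W}_{\le N}=\bigsqcup_{k=0}^N\mathcal{W}_k$, $\mathcal{W}_{<\infty}=\bigsqcup_{k\ge0}\mathcal{W}_k$; $\|w\|$ is the length of a word $w$; $0_k$ is the word made of $k$ letters $0$ ($0_0=\epsilon$). For a set $C$ of words, $\mathrm{Span}(C)$ is the real vector space of formal finite linear combinations of elements of $C$. Concatenation of words is extended bilinearly to $\mathrm{Span}(\mathcal{W}_{<\infty})$. The shuffle product $\sqcup\!\sqcup$ is defined inductively by $w\sqcup\!\sqcup\epsilon=\epsilon\sqcup\!\sqcup w=w$ and $(wi)\sqcup\!\sqcup(vj)=(w\sqcup\!\sqcup(vj))i+((wi)\sqcup\!\sqcup v)j$ for words $w,v$ and letters $i,j$, and extended bilinearly. For a word $w$, $P(w)$ is the word obtained by deleting all letters $0$ from $w$. $\mathcal{PW}_{\le N}=P(\mathcal{W}_{\le N})$ is the set of words of length at most $N$ with no letter $0$ (pure words).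 For $\gamma\in \mathcal{PW}_{\le N}$: $\mathcal{W}_N(\gamma)=\{w\in\mathcal{W}_N: P(w)=\gamma\}$ and $\mathcal{W}_{\le N}(\gamma)=\{w\in\mathcal{W}_{\le N}:P(w)=\gamma\}$. A subset $B\subset\mathcal{W}_{\le N}$ is a basis of words for $\mathcal{W}_N$ if the family $(w\sqcup\!\sqcup 0_{N-\|w\|})_{w\in B}$ is a basis of $\mathrm{Span}(\mathcal{W}_N)$. A subset $B\subset\mathcal{W}_{\le N}(\gamma)$ is a basis of words for $\mathcal{W}_N(\gamma)$ if the family $(w\sqcup\!\sqcup 0_{N-\|w\|})_{w\in B}$ is a basis of $\mathrm{Span}(\mathcal{W}_N(\gamma))$. *)

theory Defs
  imports "HOL-Analysis.Finite_Function_Topology"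
begin

type_synonym word = "nat list"

text \<open>
  Formal finite real linear combinations of words; the real vector space structure on
  \<^typ>\<open>word \<Rightarrow>\<^sub>0 real\<close> is the pointwise one.
\<close>

type_synonym formal = "word \<Rightarrow>\<^sub>0 real"

definition of_word :: "word \<Rightarrow> formal"
  where "of_word w = Poly_Mapping.single w 1"

definition Span :: "word set \<Rightarrow> formal set"
  where "Span C = span (of_word ` C)"

definition words :: "nat \<Rightarrow> nat \<Rightarrow> word set"
  where "words d N = {w. set w \<subseteq> {0..d} \<and> length w = N}"

definition words_le :: "nat \<Rightarrow> nat \<Rightarrow> word set"
  where "words_le d N = (\<Union>k\<in>{0..N}. words d k)"

definition zeros :: "nat \<Rightarrow> word"
  where "zeros k = replicate k 0"

definition purify :: "word \<Rightarrow> word"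
  where "purify w = filter (\<lambda>i. i \<noteq> 0) w"

definition pure_words_le :: "nat \<Rightarrow> nat \<Rightarrow> word set"
  where "pure_words_le d N = purify ` words_le d N"

definition words_over :: "nat \<Rightarrow> nat \<Rightarrow> word \<Rightarrow> word set"
  where "words_over d N \<gamma> = {w \<in> words d N. purify w = \<gamma>}"

definition words_le_over :: "nat \<Rightarrow> nat \<Rightarrow> word \<Rightarrow> word set"
  where "words_le_over d N \<gamma> = {w \<in> words_le d N. purify w = \<gamma>}"

definition concat_formal :: "formal \<Rightarrow> formal \<Rightarrow> formal"
  where "concat_formal p q =
    (\<Sum>u\<in>Poly_Mapping.keys p. \<Sum>v\<in>Poly_Mapping.keys q.
      (Poly_Mapping.lookup p u * Poly_Mapping.lookup q v) *\<^sub>R of_word (u @ v))"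

text \<open>
  The shuffle product counts multiplicities, unlike \<^const>\<open>shuffles\<close>, which is only the
  set of words that occur in it. The recursion is on the last letters of the two words.
\<close>

function shuffle :: "word \<Rightarrow> word \<Rightarrow> formal" where
  "shuffle w v =
    (if v = [] then of_word w
     else if w = [] then of_word v
     else concat_formal (shuffle (butlast w) v) (of_word [last w])
        + concat_formal (shuffle w (butlast v)) (of_word [last v]))"
  by auto
termination
  by (relation "measure (\<lambda>(w, v). length w + length v)") auto

declare shuffle.simps [simp del]

lemma shuffle_Nil_right [simp]: "shuffle w [] = of_word w"
  by (simp add: shuffle.simps)

lemma shuffle_Nil_left [simp]: "shuffle [] v = of_word v"
  by (simp add: shuffle.simps)

lemma shuffle_snoc:
  "shuffle (w @ [i]) (v @ [j]) =
    concat_formal (shuffle w (v @ [j])) (of_word [i])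
    + concat_formal (shuffle (w @ [i]) v) (of_word [j])"
  by (subst shuffle.simps) simp

text \<open>
  Injectivity is needed because a family with a repeated member is linearly dependent,
  even if its range is an independent set.
\<close>

definition basis_family :: "'i set \<Rightarrow> ('i \<Rightarrow> 'v::real_vector) \<Rightarrow> 'v set \<Rightarrow> bool"
  where "basis_family I f V \<longleftrightarrow>
    inj_on f I \<and> independent (f ` I) \<and> span (f ` I) = V"

definition basis_of_words :: "nat \<Rightarrow> nat \<Rightarrow> word set \<Rightarrow> bool"
  where "basis_of_words d N B \<longleftrightarrow>
    B \<subseteq> words_le d N \<and>
    basis_family B (\<lambda>w. shuffle w (zeros (N - length w))) (Span (words d N))"

definition basis_of_words_over :: "nat \<Rightarrow> nat \<Rightarrow> word \<Rightarrow> word set \<Rightarrow> bool"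
  where "basis_of_words_over d N \<gamma> B \<longleftrightarrow>
    B \<subseteq> words_le_over d N \<gamma> \<and>
    basis_family B (\<lambda>w. shuffle w (zeros (N - length w))) (Span (words_over d N \<gamma>))"

end

(*
  Shuffling with zeros does not change the pure part of a word, so both the family
  (w sh 0_{N - |w|}) and the space Span(W_N) are graded by pure words. The linear projections
  onto the graded pieces transfer independence and spanning between the whole space and
  its pieces.
*)

theory Submission
  imports Defs
begin

text \<open>The maps \<open>\<pi> k\<close> separate the pieces \<open>V k\<close>, so the sum of
  the pieces is direct although it is written as the span of a union. The map \<open>c\<close> gives
  each index its degree. Since \<open>f i\<close> is homogeneous, each \<open>\<pi> k\<close> either
  fixes or kills it.\<close>

lemma basis_family_graded_iff:
  fixes f :: "'i \<Rightarrow> 'v::real_vector" and V :: "'k \<Rightarrow> 'v set" and \<pi> :: "'k \<Rightarrow> 'v \<Rightarrow> 'v"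
  assumes lin: "\<And>k. linear (\<pi> k)"
    and proj_same: "\<And>k x. x \<in> V k \<Longrightarrow> \<pi> k x = x"
    and proj_other: "\<And>k l x. x \<in> V l \<Longrightarrow> k \<noteq> l \<Longrightarrow> \<pi> k x = 0"
    and sub: "\<And>k. subspace (V k)"
    and c: "c ` I \<subseteq> K"
    and f: "\<And>i. i \<in> I \<Longrightarrow> f i \<in> V (c i)"
  shows "basis_family I f (span (\<Union>k\<in>K. V k)) \<longleftrightarrow>
    (\<forall>k\<in>K. basis_family {i \<in> I. c i = k} f (V k))"
proof -
  let ?I = "\<lambda>k. {i \<in> I. c i = k}"
  have proj: "\<pi> k (f i) = (if c i = k then f i else 0)" if "i \<in> I" for i k
    using f[OF that] proj_same proj_other by auto
  show ?thesis
  proof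
    assume "basis_family I f (span (\<Union>k\<in>K. V k))"
    then have inj: "inj_on f I" and ind: "independent (f ` I)"
      and sp: "span (f ` I) = span (\<Union>k\<in>K. V k)"
      by (auto simp: basis_family_def)
    show "\<forall>k\<in>K. basis_family (?I k) f (V k)"
    proof
      fix k assume "k \<in> K"
      have "span (f ` ?I k) = V k"
      proof
        show "span (f ` ?I k) \<subseteq> V k"
          by (rule span_minimal) (use f sub in auto)
        show "V k \<subseteq> span (f ` ?I k)"
        proof
          fix x assume x: "x \<in> V k"
          then have "x \<in> span (f ` I)"
            using \<open>k \<in> K\<close> sp by (auto intro: span_base)
          then have "\<pi> k x \<in> span (\<pi> k ` f ` I)"
            by (simp add: linear_span_image[OF lin])
          \<comment> \<open>Members of degree other than \<open>k\<close> are sent to 0, and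
            inserting 0 leaves a span unchanged.\<close>
          also have "\<pi> k ` f ` I \<subseteq> insert 0 (f ` ?I k)"
            by (auto simp: proj)
          then have "span (\<pi> k ` f ` I) \<subseteq> span (f ` ?I k)"
            by (metis span_insert_0 span_mono)
          finally show "x \<in> span (f ` ?I k)"
            by (simp add: proj_same x)
        qed
      qed
      moreover have "inj_on f (?I k)"
        by (rule inj_on_subset[OF inj]) auto
      moreover have "independent (f ` ?I k)"
        by (rule independent_mono[OF ind]) auto
      ultimately show "basis_family (?I k) f (V k)"
        by (simp add: basis_family_def)
    qed
  next
    assume "\<forall>k\<in>K. basis_family (?I k) f (V k)"
    then have inj: "inj_on f (?I k)" and ind: "independent (f ` ?I k)"
      and sp: "span (f ` ?I k) = V k" if "k \<in> K" for k
      using that by (auto simp: basis_family_def)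
    have cK: "c i \<in> K" if "i \<in> I" for i
      using that c by auto
    \<comment> \<open>Distinct pieces may share the vector 0, so excluding it is what lets a member
      determine its degree.\<close>
    have nonzero: "f i \<noteq> 0" if "i \<in> I" for i
    proof -
      have "f i \<in> f ` ?I (c i)"
        using that by simp
      then show ?thesis
        using ind[OF cK[OF that]] dependent_zero by metis
    qed
    have "inj_on f I"
    proof (rule inj_onI)
      fix i j assume ij: "i \<in> I" "j \<in> I" "f i = f j"
      \<comment> \<open>If the degrees differed, \<open>\<pi> (c i)\<close> would fix
        \<open>f i\<close> and kill the equal vector \<open>f j\<close>, forcing
        \<open>f i = 0\<close>.\<close>
      then have "c j = c i"
        using proj[of i "c i"] proj[of j "c i"] nonzero[of i] by (auto split: if_splits)
      then show "i = j"
        using inj_onD[OF inj[OF cK[OF ij(1)]] ij(3)] ij by simp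
    qed
    moreover have "independent (f ` I)"
      unfolding dependent_def
    proof safe
      fix i assume i: "i \<in> I" and dep: "f i \<in> span (f ` I - {f i})"
      let ?k = "c i"
      have "\<pi> ?k (f i) \<in> span (\<pi> ?k ` (f ` I - {f i}))"
        using dep by (simp add: linear_span_image[OF lin])
      \<comment> \<open>A vector that survives the projection is unchanged, hence still different
        from \<open>f i\<close>. A dependence in the whole family thus becomes one inside degree
        \<open>?k\<close>.\<close>
      also have "\<pi> ?k ` (f ` I - {f i}) \<subseteq> insert 0 (f ` ?I ?k - {f i})"
        by (auto simp: proj split: if_splits)
      then have "span (\<pi> ?k ` (f ` I - {f i})) \<subseteq> span (f ` ?I ?k - {f i})"
        by (metis span_insert_0 span_mono)
      finally have "f i \<in> span (f ` ?I ?k - {f i})"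
        using i by (simp add: proj)
      moreover have "f i \<in> f ` ?I ?k"
        using i by simp
      ultimately show False
        using ind[OF cK[OF i]] unfolding dependent_def by blast
    qed
    moreover have "span (f ` I) = span (\<Union>k\<in>K. V k)"
    proof
      show "span (f ` I) \<subseteq> span (\<Union>k\<in>K. V k)"
        by (rule span_mono) (use f c in blast)
      have "V k \<subseteq> span (f ` I)" if "k \<in> K" for k
        unfolding sp[OF that, symmetric] by (rule span_mono) auto
      then show "span (\<Union>k\<in>K. V k) \<subseteq> span (f ` I)"
        by (intro span_minimal subspace_span) auto
    qed
    ultimately show "basis_family I f (span (\<Union>k\<in>K. V k))"
      by (simp add: basis_family_def)
  qed
qed

lemma lookup_scaleR:
  "Poly_Mapping.lookup (r *\<^sub>R p) w = r *\<^sub>R Poly_Mapping.lookup p w"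
  for p :: "'a \<Rightarrow>\<^sub>0 'b::real_vector"
proof -
  \<comment> \<open>Scaling is defined through an abstraction function, which can be inverted only
    on functions of finite support.\<close>
  have "finite {i. r *\<^sub>R Poly_Mapping.lookup p i \<noteq> 0}"
    by (rule finite_subset[OF _ finite_keys[of p]]) (auto simp: in_keys_iff)
  then show ?thesis
    by (simp add: scaleR_poly_mapping_def)
qed

lemma of_word_in_Span: "w \<in> C \<Longrightarrow> of_word w \<in> Span C"
  by (simp add: Span_def span_base)

lemma subspace_Span: "subspace (Span C)"
  by (simp add: Span_def)

lemma Span_mono: "C \<subseteq> D \<Longrightarrow> Span C \<subseteq> Span D"
  by (simp add: Span_def span_mono image_mono)

lemma Span_UN: "Span (\<Union>k\<in>K. C k) = span (\<Union>k\<in>K. Span (C k))"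
proof
  show "Span (\<Union>k\<in>K. C k) \<subseteq> span (\<Union>k\<in>K. Span (C k))"
    unfolding Span_def[of "\<Union>k\<in>K. C k"]
    by (rule span_mono) (auto intro: of_word_in_Span)
  show "span (\<Union>k\<in>K. Span (C k)) \<subseteq> Span (\<Union>k\<in>K. C k)"
    by (intro span_minimal subspace_Span UN_least Span_mono) auto
qed

text \<open>The combinations supported in \<open>C\<close> form a subspace that contains the
  generators \<open>of_word w\<close> with \<open>w\<close> in \<open>C\<close>.\<close>

lemma keys_subset_of_Span:
  assumes "p \<in> Span C"
  shows "Poly_Mapping.keys p \<subseteq> C"
proof -
  have "subspace {p :: formal. Poly_Mapping.keys p \<subseteq> C}"
    unfolding subspace_def by (auto simp: in_keys_iff lookup_scaleR dest!: subsetD[OF keys_add])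
  moreover have "of_word ` C \<subseteq> {p. Poly_Mapping.keys p \<subseteq> C}"
    by (auto simp: of_word_def)
  ultimately show ?thesis
    using assms span_minimal unfolding Span_def by blast
qed

lemma concat_formal_in_Span:
  assumes "p \<in> Span C" "q \<in> Span D"
  shows "concat_formal p q \<in> Span {u @ v |u v. u \<in> C \<and> v \<in> D}"
  unfolding concat_formal_def
  using keys_subset_of_Span[OF assms(1)] keys_subset_of_Span[OF assms(2)]
  by (intro subspace_sum subspace_scale subspace_Span of_word_in_Span) auto

text \<open>The set \<open>shuffles\<close> recurses on first letters, while \<open>shuffle\<close>
  recurses on last letters; appending on the right bridges the two.\<close>

lemma snoc_in_shuffles_leftI: "zs \<in> shuffles xs ys \<Longrightarrow> zs @ [z] \<in> shuffles (xs @ [z]) ys"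
proof (induction xs ys arbitrary: zs rule: shuffles.induct)
  case (1 ys)
  \<comment> \<open>For an empty left word, the new letter has to pass behind all of
    \<open>ys\<close>, which takes an induction of its own.\<close>
  have "ys @ [z] \<in> shuffles [z] ys"
    by (induction ys) (auto simp: Cons_in_shuffles_rightI)
  with 1 show ?case by simp
qed auto

lemma snoc_in_shuffles_rightI: "zs \<in> shuffles xs ys \<Longrightarrow> zs @ [z] \<in> shuffles xs (ys @ [z])"
  by (metis shuffles_commutes snoc_in_shuffles_leftI)

text \<open>The grading depends only on which words occur, not on their multiplicities, so the facts
  about the set \<open>shuffles\<close> on lengths, letters and filters become available.\<close>

lemma shuffle_in_Span_shuffles: "shuffle w v \<in> Span (shuffles w v)"
proof (induction w v rule: shuffle.induct)
  case (1 w v)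
  show ?case
  proof (cases "w = [] \<or> v = []")
    case True
    then show ?thesis by (auto intro: of_word_in_Span)
  next
    case False
    then obtain w' i v' j where wv: "w = w' @ [i]" "v = v' @ [j]"
      by (metis rev_exhaust)
    have "concat_formal (shuffle w' v) (of_word [i]) \<in> Span (shuffles w v)"
      by (rule subsetD[OF Span_mono concat_formal_in_Span[of _ "shuffles w' v" _ "{[i]}"]])
        (use 1(1) wv in \<open>auto intro: of_word_in_Span snoc_in_shuffles_leftI\<close>)
    moreover have "concat_formal (shuffle w v') (of_word [j]) \<in> Span (shuffles w v)"
      by (rule subsetD[OF Span_mono concat_formal_in_Span[of _ "shuffles w v'" _ "{[j]}"]])
        (use 1(2) wv in \<open>auto intro: of_word_in_Span snoc_in_shuffles_rightI\<close>)
    ultimately show ?thesis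
      unfolding wv shuffle_snoc by (intro subspace_add subspace_Span)
  qed
qed

text \<open>Filtering commutes with shuffling and turns the block of zeros into the empty
  word.\<close>

lemma purify_shuffles_zeros:
  assumes "u \<in> shuffles w (zeros k)"
  shows "purify u = purify w"
proof -
  have "purify u \<in> shuffles (purify w) (purify (zeros k))"
    using assms filter_shuffles unfolding purify_def by blast
  then show ?thesis
    by (simp add: purify_def zeros_def)
qed

text \<open>As \<open>length w \<le> N\<close>, the truncated subtraction is exact and every word in
  the shuffle has length \<open>N\<close>.\<close>

lemma shuffle_zeros_in_Span:
  assumes "w \<in> words_le d N"
  shows "shuffle w (zeros (N - length w)) \<in> Span (words_over d N (purify w))"
proof -
  have "u \<in> words_over d N (purify w)" if u: "u \<in> shuffles w (zeros (N - length w))" for u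
    using assms length_shuffles[OF u] set_shuffles[OF u] purify_shuffles_zeros[OF u]
    by (auto simp: words_over_def words_le_def words_def zeros_def split: if_splits)
  then have "shuffles w (zeros (N - length w)) \<subseteq> words_over d N (purify w)"
    by blast
  then show ?thesis
    using Span_mono shuffle_in_Span_shuffles by blast
qed

text \<open>The projection onto the piece of degree \<open>\<gamma>\<close>. It acts on all formal
  sums, whatever their alphabet and lengths, and is therefore linear on the whole space.\<close>

definition pure_part :: "word \<Rightarrow> formal \<Rightarrow> formal"
  where "pure_part \<gamma> = Poly_Mapping.mapp (\<lambda>w x. if purify w = \<gamma> then x else 0)"

lemma lookup_pure_part:
  "Poly_Mapping.lookup (pure_part \<gamma> p) w = (if purify w = \<gamma> then Poly_Mapping.lookup p w else 0)"
  by (auto simp: pure_part_def lookup_mapp in_keys_iff when_def)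

lemma linear_pure_part: "linear (pure_part \<gamma>)"
  by (rule linearI; rule poly_mapping_eqI)
    (simp_all add: lookup_pure_part lookup_add lookup_scaleR)

lemma pure_part_Span_words_over:
  assumes "p \<in> Span (words_over d N \<delta>)"
  shows "pure_part \<gamma> p = (if \<gamma> = \<delta> then p else 0)"
proof (rule poly_mapping_eqI)
  fix w
  have "purify w = \<delta>" if "Poly_Mapping.lookup p w \<noteq> 0"
    using keys_subset_of_Span[OF assms] that by (auto simp: in_keys_iff words_over_def)
  then show "Poly_Mapping.lookup (pure_part \<gamma> p) w =
      Poly_Mapping.lookup (if \<gamma> = \<delta> then p else 0) w"
    by (auto simp: lookup_pure_part)
qed

lemma words_eq_UN_words_over: "words d N = (\<Union>\<gamma>\<in>pure_words_le d N. words_over d N \<gamma>)"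
  by (auto simp: words_over_def pure_words_le_def words_le_def)

theorem theorem1:
  fixes d N :: nat and B :: "word set"
  assumes "d \<ge> 1"
    and "B \<subseteq> words_le d N"
  shows "basis_of_words d N B \<longleftrightarrow>
    (\<forall>\<gamma>\<in>pure_words_le d N. basis_of_words_over d N \<gamma> (B \<inter> words_le_over d N \<gamma>))"
proof -
  let ?f = "\<lambda>w. shuffle w (zeros (N - length w))"
  let ?V = "\<lambda>\<gamma>. Span (words_over d N \<gamma>)"
  \<comment> \<open>The degree of a word is \<open>purify w\<close>; it lies in the index set
    because \<open>B\<close> consists of words of length at most \<open>N\<close>.\<close>
  have "basis_family B ?f (span (\<Union>\<gamma>\<in>pure_words_le d N. ?V \<gamma>)) \<longleftrightarrow>
      (\<forall>\<gamma>\<in>pure_words_le d N. basis_family {w \<in> B. purify w = \<gamma>} ?f (?V \<gamma>))"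
    using assms(2)
    by (intro basis_family_graded_iff[where \<pi> = pure_part])
      (auto simp: linear_pure_part pure_part_Span_words_over subspace_Span pure_words_le_def
        intro: shuffle_zeros_in_Span)
  moreover have "B \<inter> words_le_over d N \<gamma> = {w \<in> B. purify w = \<gamma>}" for \<gamma>
    using assms(2) by (auto simp: words_le_over_def)
  ultimately show ?thesis
    using assms(2)
    by (auto simp: basis_of_words_def basis_of_words_over_def words_eq_UN_words_over Span_UN
        words_le_over_def)
qed

end
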